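(* Suppose $(G,X,A)$ is an A/QI triple and $B<G$ is an infinite subgroup quasi-isometrically embedded by the action $G\curvearrowright X$. Then $(G,X,A\cap B)$ is an A/QI triple.
   Context: A hyperbolic space is a Gromov hyperbolic geodesic metric space $(X,d)$; all actions are by isometries. $G$ is not assumed finitely generated. For $Y\subseteq X$, an action $G\curvearrowright X$ is acylindrical along $Y$ if for every $\varepsilon\ge 0$ there are $R=R(\varepsilon,Y)>0$ and $M=M(\varepsilon,Y)>0$ so that, whenever $x,y\in Y$ satisfy $d(x,y)\ge R$, $\#\{g\in G\mid d(gx,x)\le\varepsilon \text{ and } d(gy,y)\le\varepsilon\}\le M$. For $H<G$, the action is acylindrical along $H$ if it is acylindrical along $Hx$ for some (equivalently any) $x\in X$. A finitely generated subgroup $H<G$ is quasi-isometrically embedded by the action if the orbit map $h\mapsto hx$ (for $x\in X$) is a quasi-isometric embedding of $H$, with a word metric from a finite generating set, into $X$. An A/QI triple $(G,X,H)$ consists of a Gromov hyperbolic space $X$ and an action $G\curvearrowright X$ which is acylindrical along the finitely generated infinite subgroup $H$ of $G$, and so that $H$ is quasi-isometrically embedded by the action.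
   Formalization: That A∩B gives an A/QI triple is stated only when A∩B is infinite, as the definition demands (it fails for A=⟨a⟩, B=⟨b⟩ in a free group); finite generation, acylindricity along A∩B and quasi-isometric embedding are stated without that condition. *)

theory Defs
  imports Complex_Main "HOL-Algebra.Group_Action" "HOL-Algebra.Generated_Groups"
begin

subsection \<open>Gromov hyperbolic geodesic spaces\<close>

definition geodesic_segment :: "'x::metric_space \<Rightarrow> 'x \<Rightarrow> 'x set \<Rightarrow> bool" where
  "geodesic_segment x y S \<longleftrightarrow>
     (\<exists>p :: real \<Rightarrow> 'x. p 0 = x \<and> p (dist x y) = y \<and> S = p ` {0..dist x y} \<and>
        (\<forall>s\<in>{0..dist x y}. \<forall>t\<in>{0..dist x y}. dist (p s) (p t) = \<bar>s - t\<bar>))"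

definition geodesic_space :: "'x::metric_space itself \<Rightarrow> bool" where
  "geodesic_space (_ :: 'x itself) \<longleftrightarrow> (\<forall>x y :: 'x. \<exists>S. geodesic_segment x y S)"

text \<open>Every geodesic triangle is \<open>\<delta>\<close>-slim. Geodesic segments carry no orientation
  (\<open>geodesic_segment x y S\<close> iff \<open>geodesic_segment y x S\<close>), so the condition on the side \<open>P\<close>,
  required for all triangles, covers all three sides.\<close>

definition slim_triangles :: "'x::metric_space itself \<Rightarrow> real \<Rightarrow> bool" where
  "slim_triangles (_ :: 'x itself) \<delta> \<longleftrightarrow>
     (\<forall>(x::'x) y z P Q R.
        geodesic_segment x y P \<and> geodesic_segment y z Q \<and> geodesic_segment z x R \<longrightarrow>
        (\<forall>p\<in>P. \<exists>q\<in>Q \<union> R. dist p q \<le> \<delta>))"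

definition hyperbolic_space :: "'x::metric_space itself \<Rightarrow> bool" where
  "hyperbolic_space T \<longleftrightarrow> geodesic_space T \<and> (\<exists>\<delta>\<ge>0. slim_triangles T \<delta>)"

subsection \<open>Isometric actions and acylindricity\<close>

definition isometric_action ::
    "('g, 'm) monoid_scheme \<Rightarrow> ('g \<Rightarrow> 'x::metric_space \<Rightarrow> 'x) \<Rightarrow> bool" where
  "isometric_action G \<phi> \<longleftrightarrow>
     group_action G UNIV \<phi> \<and> (\<forall>g\<in>carrier G. \<forall>x y. dist (\<phi> g x) (\<phi> g y) = dist x y)"

text \<open>Finiteness is stated separately because \<open>card\<close> of an infinite set is \<open>0\<close>.\<close>

definition acylindrical_along_set ::
    "('g, 'm) monoid_scheme \<Rightarrow> ('g \<Rightarrow> 'x::metric_space \<Rightarrow> 'x) \<Rightarrow> 'x set \<Rightarrow> bool" where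
  "acylindrical_along_set G \<phi> Y \<longleftrightarrow>
     (\<forall>\<epsilon>::real. \<epsilon> \<ge> 0 \<longrightarrow> (\<exists>R::real. \<exists>M::nat. R > 0 \<and> M > 0 \<and>
        (\<forall>x\<in>Y. \<forall>y\<in>Y. dist x y \<ge> R \<longrightarrow>
           finite {g \<in> carrier G. dist (\<phi> g x) x \<le> \<epsilon> \<and> dist (\<phi> g y) y \<le> \<epsilon>} \<and>
           card {g \<in> carrier G. dist (\<phi> g x) x \<le> \<epsilon> \<and> dist (\<phi> g y) y \<le> \<epsilon>} \<le> M)))"

definition acylindrical_along_subgroup ::
    "('g, 'm) monoid_scheme \<Rightarrow> ('g \<Rightarrow> 'x::metric_space \<Rightarrow> 'x) \<Rightarrow> 'g set \<Rightarrow> bool" where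
  "acylindrical_along_subgroup G \<phi> H \<longleftrightarrow>
     (\<exists>x. acylindrical_along_set G \<phi> ((\<lambda>h. \<phi> h x) ` H))"

subsection \<open>Word metrics and quasi-isometrically embedded subgroups\<close>

definition finite_generating_set :: "('g, 'm) monoid_scheme \<Rightarrow> 'g set \<Rightarrow> 'g set \<Rightarrow> bool" where
  "finite_generating_set G H S \<longleftrightarrow> finite S \<and> S \<subseteq> carrier G \<and> generate G S = H"

definition finitely_generated :: "('g, 'm) monoid_scheme \<Rightarrow> 'g set \<Rightarrow> bool" where
  "finitely_generated G H \<longleftrightarrow> (\<exists>S. finite_generating_set G H S)"

text \<open>Only meaningful for \<open>g \<in> generate G S\<close>.\<close>

definition word_length :: "('g, 'm) monoid_scheme \<Rightarrow> 'g set \<Rightarrow> 'g \<Rightarrow> nat" where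
  "word_length G S g =
     (LEAST n. \<exists>ws. length ws = n \<and> set ws \<subseteq> S \<union> (\<lambda>s. inv\<^bsub>G\<^esub> s) ` S \<and>
        foldr (\<lambda>a b. a \<otimes>\<^bsub>G\<^esub> b) ws \<one>\<^bsub>G\<^esub> = g)"

definition word_dist :: "('g, 'm) monoid_scheme \<Rightarrow> 'g set \<Rightarrow> 'g \<Rightarrow> 'g \<Rightarrow> real" where
  "word_dist G S g h = real (word_length G S (inv\<^bsub>G\<^esub> g \<otimes>\<^bsub>G\<^esub> h))"

definition quasi_isometric_embedding ::
    "'a set \<Rightarrow> ('a \<Rightarrow> 'a \<Rightarrow> real) \<Rightarrow> ('a \<Rightarrow> 'x::metric_space) \<Rightarrow> bool" where
  "quasi_isometric_embedding A d f \<longleftrightarrow>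
     (\<exists>K\<ge>1. \<exists>C\<ge>0. \<forall>a\<in>A. \<forall>b\<in>A.
        d a b / K - C \<le> dist (f a) (f b) \<and> dist (f a) (f b) \<le> K * d a b + C)"

text \<open>Being quasi-isometrically embedded depends neither on the finite generating set nor on the
  base point; in particular it includes finite generation of \<open>H\<close>.\<close>

definition qi_embedded ::
    "('g, 'm) monoid_scheme \<Rightarrow> ('g \<Rightarrow> 'x::metric_space \<Rightarrow> 'x) \<Rightarrow> 'g set \<Rightarrow> bool" where
  "qi_embedded G \<phi> H \<longleftrightarrow>
     (\<exists>S x. finite_generating_set G H S \<and>
        quasi_isometric_embedding H (word_dist G S) (\<lambda>h. \<phi> h x))"

subsection \<open>A/QI triples\<close>

definition AQI_triple ::
    "('g, 'm) monoid_scheme \<Rightarrow> ('g \<Rightarrow> 'x::metric_space \<Rightarrow> 'x) \<Rightarrow> 'g set \<Rightarrow> bool" where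
  "AQI_triple G \<phi> H \<longleftrightarrow>
     hyperbolic_space TYPE('x) \<and> group G \<and> isometric_action G \<phi> \<and>
     subgroup H G \<and> finitely_generated G H \<and> infinite H \<and>
     acylindrical_along_subgroup G \<phi> H \<and> qi_embedded G \<phi> H"

end

theory Submission
  imports Defs "HOL-Real_Asymp.Real_Asymp"
begin

text \<open>Orbits of quasi-isometrically embedded subgroups are quasiconvex: two orbit points are joined
  inside the orbit by a chain of bounded steps whose length is linear in their distance, and in a
  hyperbolic space a geodesic stays logarithmically close, in the length of the chain, to any chain
  joining its end points. If a point \<open>p\<close> of a geodesic between two points of the orbit of
  \<open>A \<inter> B\<close> is close to both \<open>a x\<close> and \<open>b x\<close>, then acylindricity along \<open>A\<close> leaves only finitely many
  possibilities for \<open>a\<inverse> b\<close>, so \<open>p\<close> is close to the orbit of \<open>A \<inter> B\<close>. This orbit is therefore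
  quasiconvex, and a subgroup with quasiconvex orbit that has finitely many elements of each bounded
  displacement is generated by those of small displacement and is quasi-isometrically embedded.\<close>

section \<open>Geodesics in hyperbolic spaces\<close>

lemma geodesic_segment_commute:
  assumes "geodesic_segment x y S"
  shows "geodesic_segment y x S"
proof -
  obtain p where p: "p 0 = x" "p (dist x y) = y" "S = p ` {0..dist x y}"
    "\<And>s t. s \<in> {0..dist x y} \<Longrightarrow> t \<in> {0..dist x y} \<Longrightarrow> dist (p s) (p t) = \<bar>s - t\<bar>"
    using assms unfolding geodesic_segment_def by blast
  let ?q = "\<lambda>t. p (dist x y - t)"
  have "(\<lambda>t. dist x y - t) ` {0..dist x y} = {0..dist x y}"
    by (auto simp: image_iff intro!: bexI[of _ "dist x y - t" for t])
  then have "S = ?q ` {0..dist x y}"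
    using p(3) by (metis image_image)
  then show ?thesis
    unfolding geodesic_segment_def
    by (intro exI[of _ ?q]) (auto simp: p(1,2,4) dist_commute[of y x])
qed

lemma geodesic_segment_dist_le:
  assumes "geodesic_segment x y S" "p \<in> S"
  shows "dist p x \<le> dist x y"
  using assms unfolding geodesic_segment_def by force

lemma slim_triangleE:
  fixes x y z :: "'x::metric_space"
  assumes "slim_triangles TYPE('x) \<delta>"
    and "geodesic_segment x y P" "geodesic_segment x z Q" "geodesic_segment z y R" "p \<in> P"
  obtains q where "q \<in> Q" "dist p q \<le> \<delta>" | q where "q \<in> R" "dist p q \<le> \<delta>"
  using assms(1)[unfolded slim_triangles_def] assms(2-5) geodesic_segment_commute
  by (metis Un_iff)

text \<open>Bisect the chain and apply slimness to the triangle on its end points and its middle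
  point. Each halving costs one \<open>\<delta>\<close>; after \<open>k\<close> halvings at most one
  step of length \<open>L\<close> is left.\<close>

lemma geodesic_near_chain:
  fixes f :: "nat \<Rightarrow> 'x::metric_space"
  assumes "geodesic_space TYPE('x)" "slim_triangles TYPE('x) \<delta>"
    and "\<And>i. i < n \<Longrightarrow> dist (f i) (f (Suc i)) \<le> L"
    and "n \<le> 2 ^ k" "0 \<le> L" "geodesic_segment (f 0) (f n) S" "p \<in> S"
  shows "\<exists>i\<le>n. dist p (f i) \<le> real k * \<delta> + L"
  using assms(3,4,6,7)
proof (induction k arbitrary: f n S p)
  case 0
  have "dist p (f 0) \<le> dist (f 0) (f n)"
    using geodesic_segment_dist_le 0 by blast
  also have "\<dots> \<le> L"
    using 0(1)[of 0] 0(2) \<open>0 \<le> L\<close> by (cases n) auto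
  finally show ?case by auto
next
  case (Suc k)
  \<comment> \<open>Both halves have at most \<open>2 ^ k\<close> steps; if already
    \<open>n \<le> 2 ^ k\<close>, the second half has no steps.\<close>
  define m where "m = min n (2 ^ k)"
  have m: "m \<le> n" "m \<le> 2 ^ k" "n - m \<le> 2 ^ k"
    using Suc.prems(2) by (auto simp: m_def)
  obtain Q R where Q: "geodesic_segment (f 0) (f m) Q" and R: "geodesic_segment (f m) (f n) R"
    using assms(1) unfolding geodesic_space_def by metis
  show ?case
  proof (rule slim_triangleE[OF assms(2) Suc.prems(3) Q R Suc.prems(4)])
    fix q assume q: "q \<in> Q" "dist p q \<le> \<delta>"
    obtain i where "i \<le> m" "dist q (f i) \<le> real k * \<delta> + L"
      using Suc.IH[OF _ m(2) Q q(1)] Suc.prems(1) m(1) by auto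
    then show ?thesis
      using m(1) q(2) dist_triangle[of p "f i" q] by (intro exI[of _ i]) (auto simp: algebra_simps)
  next
    fix q assume q: "q \<in> R" "dist p q \<le> \<delta>"
    obtain i where "i \<le> n - m" "dist q (f (m + i)) \<le> real k * \<delta> + L"
      using Suc.IH[of "n - m" "\<lambda>i. f (m + i)" R q] Suc.prems(1) m R q by auto
    then show ?thesis
      using m(1) q(2) dist_triangle[of p "f (m + i)" q]
      by (intro exI[of _ "m + i"]) (auto simp: algebra_simps)
  qed
qed

section \<open>Quasiconvexity from chains of linear length\<close>

definition quasiconvex_with :: "real \<Rightarrow> 'x::metric_space set \<Rightarrow> bool" where
  "quasiconvex_with D Y \<longleftrightarrow>
     (\<forall>u\<in>Y. \<forall>v\<in>Y. \<forall>S. geodesic_segment u v S \<longrightarrow> (\<forall>p\<in>S. \<exists>q\<in>Y. dist p q \<le> D))"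

definition joined_by_chain :: "'x::metric_space set \<Rightarrow> real \<Rightarrow> nat \<Rightarrow> 'x \<Rightarrow> 'x \<Rightarrow> bool" where
  "joined_by_chain Y L n u v \<longleftrightarrow>
     (\<exists>f. f 0 = u \<and> f n = v \<and> (\<forall>i\<le>n. f i \<in> Y) \<and> (\<forall>i<n. dist (f i) (f (Suc i)) \<le> L))"

lemma joined_by_chain_Suc:
  assumes "u \<in> Y" "dist u w \<le> L" "joined_by_chain Y L n w v"
  shows "joined_by_chain Y L (Suc n) u v"
proof -
  obtain f where f: "f 0 = w" "f n = v" "\<forall>i\<le>n. f i \<in> Y" "\<forall>i<n. dist (f i) (f (Suc i)) \<le> L"
    using assms(3) unfolding joined_by_chain_def by blast
  let ?g = "case_nat u f"
  have "\<forall>i\<le>Suc n. ?g i \<in> Y" "\<forall>i<Suc n. dist (?g i) (?g (Suc i)) \<le> L"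
    using assms(1,2) f by (auto split: nat.split)
  then show ?thesis
    unfolding joined_by_chain_def using f by (intro exI[of _ ?g]) auto
qed

lemma joined_by_chain_dist_le:
  assumes "joined_by_chain Y L n u v"
  shows "dist u v \<le> real n * L"
proof -
  obtain f where f: "f 0 = u" "f n = v" "\<forall>i<n. dist (f i) (f (Suc i)) \<le> L"
    using assms unfolding joined_by_chain_def by blast
  have "dist (f 0) (f m) \<le> real m * L" if "m \<le> n" for m
    using that
  proof (induction m)
    case (Suc m)
    then show ?case
      using f(3) dist_triangle[of "f 0" "f (Suc m)" "f m"]
      by (force simp: algebra_simps dest: spec[of _ m])
  qed simp
  then show ?thesis using f by auto
qed

text \<open>Finds the scales \<open>n\<close> at which the descent works: \<open>2 ^ k\<close>
  dominates the number of chain steps, while the error logarithmic in that number stays below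
  \<open>n\<close>. A \<open>k\<close> proportional to \<open>n\<close> with small slope does
  both.\<close>

lemma exp_scale_beats_linear:
  fixes a c \<delta> L :: real
  assumes "0 \<le> a" "0 \<le> \<delta>"
  obtains N :: nat where "\<And>n. N \<le> n \<Longrightarrow> \<exists>k. a * real n + c \<le> 2 ^ k \<and> (real k + 2) * \<delta> + L \<le> real n"
proof -
  \<comment> \<open>The slope \<open>1 / q\<close> lets \<open>k * \<delta>\<close> use at most half
    of \<open>n\<close>; the \<open>+ 1\<close> keeps \<open>q\<close> positive when
    \<open>\<delta> = 0\<close>.\<close>
  define q where "q = nat \<lceil>2 * (\<delta> + 1)\<rceil>"
  have q: "2 * (\<delta> + 1) \<le> real q" "0 < q"
    using assms(2) by (simp_all add: q_def) linarith+
  have "eventually (\<lambda>k. (a * real q) * (real k + 1) + c \<le> 2 ^ k) sequentially"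
    by real_asymp
  then obtain k0 where k0: "\<And>k. k0 \<le> k \<Longrightarrow> (a * real q) * (real k + 1) + c \<le> 2 ^ k"
    unfolding eventually_sequentially by blast
  \<comment> \<open>The first entry forces \<open>k0 \<le> n div q\<close>; the second fits
    \<open>2 * \<delta> + L\<close> into the other half of \<open>n\<close>.\<close>
  define N where "N = max (q * k0) (nat \<lceil>2 * (2 * \<delta> + L)\<rceil>)"
  have "\<exists>k. a * real n + c \<le> 2 ^ k \<and> (real k + 2) * \<delta> + L \<le> real n" if "N \<le> n" for n
  proof (intro exI conjI)
    let ?k = "n div q"
    have "q * k0 \<le> n" using that by (simp add: N_def)
    then have "k0 \<le> ?k" using q(2) by (simp add: less_eq_div_iff_mult_less_eq mult.commute)
    have "n \<le> q * (?k + 1)"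
      using q(2) by (metis Suc_eq_plus1 dividend_less_times_div less_imp_le mult_Suc_right add.commute)
    then have "real n \<le> real q * (real ?k + 1)"
      by (metis of_nat_1 of_nat_add of_nat_le_iff of_nat_mult)
    then have "a * real n \<le> a * (real q * (real ?k + 1))"
      using assms(1) by (rule mult_left_mono)
    also have "\<dots> + c \<le> 2 ^ ?k"
      using k0[OF \<open>k0 \<le> ?k\<close>] by (simp add: mult.assoc)
    finally show "a * real n + c \<le> 2 ^ ?k" by simp
    have "real ?k * (2 * \<delta>) \<le> real ?k * real q"
      using q(1) by (intro mult_left_mono) auto
    also have "\<dots> \<le> real n"
      by (metis div_times_less_eq_dividend of_nat_le_iff of_nat_mult)
    finally have "real ?k * \<delta> \<le> real n / 2" by simp
    moreover have "2 * (2 * \<delta> + L) \<le> real n"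
      using that unfolding N_def by linarith
    ultimately show "(real ?k + 2) * \<delta> + L \<le> real n"
      by (simp add: algebra_simps)
  qed
  then show thesis using that by blast
qed

lemma geodesic_subsegment:
  assumes "\<And>s t. s \<in> {0..l} \<Longrightarrow> t \<in> {0..l} \<Longrightarrow> dist (\<gamma> s) (\<gamma> t) = \<bar>s - t\<bar>"
    and "0 \<le> a" "a \<le> b" "b \<le> (l::real)"
  shows "geodesic_segment (\<gamma> a) (\<gamma> b) (\<gamma> ` {a..b})"
proof -
  have d: "dist (\<gamma> a) (\<gamma> b) = b - a" using assms by auto
  have "\<gamma> ` {a..b} = (\<lambda>t. \<gamma> (a + t)) ` {0..b - a}"
    using image_add_atLeastAtMost[of a 0 "b - a"] by (simp add: image_image[of \<gamma> "(+) a", symmetric])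
  then show ?thesis
    unfolding geodesic_segment_def d using assms
    by (intro exI[of _ "\<lambda>t. \<gamma> (a + t)"]) auto
qed

text \<open>If a point of the geodesic were farther than \<open>n\<close> from \<open>Y\<close>, the chain between the projections
  of two geodesic points around it at distance of order \<open>n\<close> would have at most \<open>2 ^ k\<close> steps with
  \<open>k\<close> too small to keep the geodesic that far away.\<close>

lemma quasiconvex_descent:
  fixes Y :: "'x::metric_space set"
  assumes geo: "geodesic_space TYPE('x)" and slim: "slim_triangles TYPE('x) \<delta>" "0 \<le> \<delta>"
    and chain: "\<And>u v. u \<in> Y \<Longrightarrow> v \<in> Y \<Longrightarrow>
      \<exists>n. real n \<le> K * dist u v + C \<and> joined_by_chain Y L n u v"
    and "0 \<le> K" "0 \<le> L"
    and iso: "\<And>s t. s \<in> {0..l} \<Longrightarrow> t \<in> {0..l} \<Longrightarrow> dist (\<gamma> s) (\<gamma> t) = \<bar>s - t\<bar>"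
    and ends: "\<gamma> 0 \<in> Y" "\<gamma> l \<in> Y"
    and E: "\<And>t. t \<in> {0..l} \<Longrightarrow> \<exists>q\<in>Y. dist (\<gamma> t) q \<le> E" "0 \<le> E"
    and k: "K * (4 * E + 4 * \<delta> + 2) + C \<le> 2 ^ k" "(real k + 2) * \<delta> + L \<le> r"
    and t: "t \<in> {0..l}"
  shows "\<exists>q\<in>Y. dist (\<gamma> t) q \<le> r"
proof (rule ccontr)
  assume far: "\<not> ?thesis"
  have r: "2 * \<delta> \<le> r"
    using k(2) \<open>0 \<le> L\<close> mult_nonneg_nonneg[OF of_nat_0_le_iff[of k] slim(2)]
    unfolding distrib_right by linarith
  \<comment> \<open>A segment of length at most \<open>E\<close> starting at distance
    \<open>s\<close> from \<open>\<gamma> t\<close> stays more than \<open>2 * \<delta>\<close> away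
    from \<open>\<gamma> t\<close>.\<close>
  define s where "s = E + 2 * \<delta> + 1"
  have s: "0 \<le> s" using E(2) slim(2) by (simp add: s_def)
  \<comment> \<open>Where the geodesic is too short to move by \<open>s\<close>, the parameter is
    cut off at an end point, which lies in \<open>Y\<close>. The side is then degenerate, and
    \<open>far\<close> with \<open>2 * \<delta> \<le> r\<close> keeps it away.\<close>
  have side: "\<exists>y'\<in>Y. dist (\<gamma> a) y' \<le> E \<and>
      (\<forall>W. geodesic_segment (\<gamma> a) y' W \<longrightarrow> (\<forall>w\<in>W. 2 * \<delta> < dist (\<gamma> t) w))"
    if a: "a \<in> {0..l}" "\<bar>t - a\<bar> = s \<or> \<gamma> a \<in> Y" for a
  proof (cases "\<gamma> a \<in> Y")
    case True
    have "2 * \<delta> < dist (\<gamma> t) w" if "geodesic_segment (\<gamma> a) (\<gamma> a) W" "w \<in> W" for w W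
    proof -
      have "w = \<gamma> a" using geodesic_segment_dist_le[OF that] by simp
      then show ?thesis using far True r by force
    qed
    then show ?thesis using True E(2) by (intro bexI[of _ "\<gamma> a"]) auto
  next
    case False
    obtain y' where y': "y' \<in> Y" "dist (\<gamma> a) y' \<le> E" using E(1) a(1) by blast
    have "2 * \<delta> < dist (\<gamma> t) w" if "geodesic_segment (\<gamma> a) y' W" "w \<in> W" for w W
    proof -
      have "dist w (\<gamma> a) \<le> E" using geodesic_segment_dist_le[OF that] y'(2) by simp
      moreover have "dist (\<gamma> t) (\<gamma> a) = s" using iso t a False by simp
      ultimately show ?thesis
        using dist_triangle[of "\<gamma> t" "\<gamma> a" w] by (simp add: s_def)
    qed
    then show ?thesis using y' by blast
  qed
  define a b where "a = max 0 (t - s)" and "b = min l (t + s)"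
  have ab: "a \<in> {0..l}" "b \<in> {0..l}" "a \<le> t" "t \<le> b" "b - a \<le> 2 * s"
    using t s by (auto simp: a_def b_def)
  have "\<bar>t - a\<bar> = s \<or> \<gamma> a \<in> Y" "\<bar>t - b\<bar> = s \<or> \<gamma> b \<in> Y"
    using s ends by (auto simp: a_def b_def max_def min_def)
  then obtain y z where
    y: "y \<in> Y" "dist (\<gamma> a) y \<le> E"
       "\<And>W w. geodesic_segment (\<gamma> a) y W \<Longrightarrow> w \<in> W \<Longrightarrow> 2 * \<delta> < dist (\<gamma> t) w" and
    z: "z \<in> Y" "dist (\<gamma> b) z \<le> E"
       "\<And>W w. geodesic_segment (\<gamma> b) z W \<Longrightarrow> w \<in> W \<Longrightarrow> 2 * \<delta> < dist (\<gamma> t) w"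
    using side[of a] side[of b] ab by metis
  have "dist (\<gamma> a) (\<gamma> b) \<le> 2 * s" using iso[of a b] ab by simp
  then have "dist y z \<le> 2 * s + 2 * E"
    using y(2) z(2) dist_triangle[of y z "\<gamma> a"] dist_triangle[of "\<gamma> a" z "\<gamma> b"]
    by (simp add: dist_commute)
  then have "K * dist y z \<le> K * (4 * E + 4 * \<delta> + 2)"
    using \<open>0 \<le> K\<close> by (intro mult_left_mono) (simp_all add: s_def)
  moreover obtain n where n: "real n \<le> K * dist y z + C" "joined_by_chain Y L n y z"
    using chain y(1) z(1) by blast
  ultimately have "real n \<le> 2 ^ k" using k(1) by linarith
  then have "n \<le> 2 ^ k" by (metis of_nat_le_iff of_nat_numeral of_nat_power)
  obtain f where f: "f 0 = y" "f n = z" "\<And>i. i \<le> n \<Longrightarrow> f i \<in> Y"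
    "\<And>i. i < n \<Longrightarrow> dist (f i) (f (Suc i)) \<le> L"
    using n(2) unfolding joined_by_chain_def by blast
  \<comment> \<open>The diagonal \<open>V\<close> cuts the quadrilateral into two slim triangles. As
    \<open>W1\<close> and \<open>W3\<close> are too far away, \<open>\<gamma> t\<close> is within
    \<open>2 * \<delta>\<close> of \<open>W2\<close>, which the chain follows.\<close>
  obtain W1 W2 W3 V where
    W: "geodesic_segment (\<gamma> a) y W1" "geodesic_segment y z W2" "geodesic_segment z (\<gamma> b) W3"
       "geodesic_segment (\<gamma> a) z V"
    using geo unfolding geodesic_space_def by metis
  have seg: "geodesic_segment (\<gamma> a) (\<gamma> b) (\<gamma> ` {a..b})"
    using geodesic_subsegment[of l \<gamma> a b] iso ab by simp
  have "\<gamma> t \<in> \<gamma> ` {a..b}" using ab by simp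
  then have "\<exists>w\<in>W2. dist (\<gamma> t) w \<le> 2 * \<delta>"
  proof (rule slim_triangleE[OF slim(1) seg W(4,3)])
    fix v assume v: "v \<in> V" "dist (\<gamma> t) v \<le> \<delta>"
    show ?thesis
    proof (rule slim_triangleE[OF slim(1) W(4,1,2) v(1)])
      fix w assume "w \<in> W1" "dist v w \<le> \<delta>"
      then show ?thesis
        using y(3)[OF W(1)] v(2) dist_triangle[of "\<gamma> t" w v] by force
    next
      fix w assume "w \<in> W2" "dist v w \<le> \<delta>"
      then show ?thesis
        using v(2) dist_triangle[of "\<gamma> t" w v] by force
    qed
  next
    fix w assume "w \<in> W3" "dist (\<gamma> t) w \<le> \<delta>"
    then show ?thesis
      using z(3)[OF geodesic_segment_commute[OF W(3)]] slim(2) by force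
  qed
  then obtain w where w: "w \<in> W2" "dist (\<gamma> t) w \<le> 2 * \<delta>" by blast
  obtain i where "i \<le> n" "dist w (f i) \<le> real k * \<delta> + L"
    using geodesic_near_chain[of \<delta> n f L k W2 w, OF geo slim(1) f(4) \<open>n \<le> 2 ^ k\<close> \<open>0 \<le> L\<close> _ w(1)]
      W(2) f(1,2) by auto
  then have "f i \<in> Y" "dist (\<gamma> t) (f i) \<le> r"
    using f(3) k(2) w(2) dist_triangle[of "\<gamma> t" "f i" w] by (auto simp: algebra_simps)
  then show False using far by blast
qed

text \<open>A first bound depending on the length of the geodesic is lowered one unit at a time by
  \<open>quasiconvex_descent\<close>, down to an \<open>N\<close> that depends only on the
  constants.\<close>

lemma quasiconvex_if_joined_by_linear_chains:
  fixes Y :: "'x::metric_space set"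
  assumes hyp: "hyperbolic_space TYPE('x)"
    and chain: "\<And>u v. u \<in> Y \<Longrightarrow> v \<in> Y \<Longrightarrow>
      \<exists>n. real n \<le> K * dist u v + C \<and> joined_by_chain Y L n u v"
    and "0 \<le> K" "0 \<le> L"
  shows "\<exists>D\<ge>0. quasiconvex_with D Y"
proof -
  obtain \<delta> where geo: "geodesic_space TYPE('x)" and slim: "slim_triangles TYPE('x) \<delta>" "0 \<le> \<delta>"
    using hyp unfolding hyperbolic_space_def by blast
  \<comment> \<open>The \<open>6\<close> is the \<open>2\<close> of
    \<open>quasiconvex_descent\<close> plus \<open>4\<close> for descending from
    \<open>N + Suc j\<close> to \<open>N + j\<close>.\<close>
  obtain N where N: "\<And>n. N \<le> n \<Longrightarrow>
      \<exists>k. (4 * K) * real n + (K * (4 * \<delta> + 6) + C) \<le> 2 ^ k \<and> (real k + 2) * \<delta> + L \<le> real n"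
    using exp_scale_beats_linear[of "4 * K" \<delta> "K * (4 * \<delta> + 6) + C" L] \<open>0 \<le> K\<close> slim(2) by auto
  have "\<exists>q\<in>Y. dist p q \<le> real N"
    if uv: "u \<in> Y" "v \<in> Y" "geodesic_segment u v S" "p \<in> S" for u v S p
  proof -
    define l where "l = dist u v"
    obtain \<gamma> where \<gamma>: "\<gamma> 0 = u" "\<gamma> l = v" "S = \<gamma> ` {0..l}"
      "\<And>s t. s \<in> {0..l} \<Longrightarrow> t \<in> {0..l} \<Longrightarrow> dist (\<gamma> s) (\<gamma> t) = \<bar>s - t\<bar>"
      using uv(3) unfolding geodesic_segment_def l_def by blast
    have "\<forall>t\<in>{0..l}. \<exists>q\<in>Y. dist (\<gamma> t) q \<le> real (N + j)
      \<Longrightarrow> \<forall>t\<in>{0..l}. \<exists>q\<in>Y. dist (\<gamma> t) q \<le> real N" for j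
    proof (induction j)
      case (Suc j)
      obtain k where k: "(4 * K) * real (N + j) + (K * (4 * \<delta> + 6) + C) \<le> 2 ^ k"
          "(real k + 2) * \<delta> + L \<le> real (N + j)"
        using N[of "N + j"] by auto
      have "K * (4 * real (N + Suc j) + 4 * \<delta> + 2) + C \<le> 2 ^ k"
        using k(1) by (simp add: algebra_simps)
      moreover have "\<gamma> 0 \<in> Y" "\<gamma> l \<in> Y" using \<gamma> uv by auto
      ultimately have "\<forall>t\<in>{0..l}. \<exists>q\<in>Y. dist (\<gamma> t) q \<le> real (N + j)"
        using quasiconvex_descent[OF geo slim chain \<open>0 \<le> K\<close> \<open>0 \<le> L\<close> \<gamma>(4) _ _
            bspec[OF Suc.prems] of_nat_0_le_iff _ k(2)]
        by blast
      then show ?case by (rule Suc.IH)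
    qed simp
    \<comment> \<open>The end point \<open>u\<close> provides the crude bound that starts the
      descent.\<close>
    moreover have "dist (\<gamma> t) u \<le> real (N + nat \<lceil>l\<rceil>)" if "t \<in> {0..l}" for t
    proof -
      have "dist (\<gamma> t) u = t" using \<gamma>(1) \<gamma>(4)[of t 0] that by simp
      then show ?thesis using that by simp linarith
    qed
    ultimately show ?thesis using uv \<gamma>(3) by blast
  qed
  then show ?thesis
    unfolding quasiconvex_with_def by (intro exI[of _ "real N"]) auto
qed

section \<open>Orbits of subgroups\<close>

locale isometric_group_action = group G
  for G :: "('g, 'm) monoid_scheme" (structure) +
  fixes \<phi> :: "'g \<Rightarrow> 'x::metric_space \<Rightarrow> 'x"
  assumes isometric: "isometric_action G \<phi>"
begin

lemma dist_act: "g \<in> carrier G \<Longrightarrow> dist (\<phi> g x) (\<phi> g y) = dist x y"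
  using isometric unfolding isometric_action_def by blast

lemma act_mult: "\<lbrakk>g \<in> carrier G; h \<in> carrier G\<rbrakk> \<Longrightarrow> \<phi> (g \<otimes> h) x = \<phi> g (\<phi> h x)"
  using isometric group_action.composition_rule[of G UNIV \<phi> x g h]
  unfolding isometric_action_def by simp

lemma act_one: "\<phi> \<one> x = x"
proof -
  have "group_action G UNIV \<phi>" using isometric by (simp add: isometric_action_def)
  from group_action.id_eq_one[OF this] have "\<phi> \<one> = (\<lambda>x\<in>UNIV. x)" by metis
  then show ?thesis by simp
qed

lemma dist_orbit:
  assumes "g \<in> carrier G" "h \<in> carrier G"
  shows "dist x (\<phi> (inv g \<otimes> h) x) = dist (\<phi> g x) (\<phi> h x)"
proof -
  have "\<phi> g (\<phi> (inv g \<otimes> h) x) = \<phi> h x"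
    using assms by (simp flip: act_mult add: m_assoc[symmetric])
  then show ?thesis using dist_act[OF assms(1), of x "\<phi> (inv g \<otimes> h) x"] by simp
qed

lemma dist_inv:
  assumes "g \<in> carrier G"
  shows "dist x (\<phi> (inv g) x) = dist x (\<phi> g x)"
  using dist_orbit[OF assms one_closed, of x] assms by (simp add: act_one dist_commute)

text \<open>Quasi-isometric embedding and acylindricity each come with their own base point; this
  transfers estimates at an additive cost.\<close>

lemma dist_change_base:
  assumes "g \<in> carrier G" "h \<in> carrier G"
  shows "dist (\<phi> g x) (\<phi> h x) \<le> dist (\<phi> g y) (\<phi> h y) + 2 * dist x y"
  using dist_triangle[of "\<phi> g x" "\<phi> h x" "\<phi> g y"] dist_triangle[of "\<phi> g y" "\<phi> h x" "\<phi> h y"]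
    dist_act[OF assms(1), of x y] dist_act[OF assms(2), of y x]
  by (simp add: dist_commute)

section \<open>Words in generators and chains in orbits\<close>

abbreviation letters :: "'g set \<Rightarrow> 'g set" where
  "letters S \<equiv> S \<union> (\<lambda>s. inv s) ` S"

abbreviation word_prod :: "'g list \<Rightarrow> 'g" where
  "word_prod ws \<equiv> foldr (\<lambda>a b. a \<otimes> b) ws \<one>"

lemma word_prod_closed: "set ws \<subseteq> carrier G \<Longrightarrow> word_prod ws \<in> carrier G"
  by (induction ws) auto

lemma word_prod_append:
  "\<lbrakk>set ws \<subseteq> carrier G; set vs \<subseteq> carrier G\<rbrakk>
    \<Longrightarrow> word_prod (ws @ vs) = word_prod ws \<otimes> word_prod vs"
  by (induction ws) (auto simp: word_prod_closed m_assoc)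

lemma word_of_generate:
  assumes "S \<subseteq> carrier G" "h \<in> generate G S"
  shows "\<exists>ws. set ws \<subseteq> letters S \<and> word_prod ws = h"
  using assms(2)
proof (induction rule: generate.induct)
  case one
  show ?case by (intro exI[of _ "[]"]) auto
next
  case (incl h)
  then show ?case using assms(1) by (intro exI[of _ "[h]"]) auto
next
  case (inv h)
  then show ?case using assms(1) by (intro exI[of _ "[inv h]"]) auto
next
  case (eng h1 h2)
  then obtain ws vs where "set ws \<subseteq> letters S" "word_prod ws = h1"
    "set vs \<subseteq> letters S" "word_prod vs = h2" by blast
  moreover have "letters S \<subseteq> carrier G" using assms(1) by auto
  ultimately show ?case
    using word_prod_append[of ws vs] by (intro exI[of _ "ws @ vs"]) auto
qed

lemma word_length_witness:
  assumes "S \<subseteq> carrier G" "h \<in> generate G S"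
  obtains ws where "length ws = word_length G S h" "set ws \<subseteq> letters S" "word_prod ws = h"
proof -
  have "\<exists>n ws. length ws = n \<and> set ws \<subseteq> letters S \<and> word_prod ws = h"
    using word_of_generate[OF assms] by blast
  from LeastI_ex[OF this] show thesis
    using that unfolding word_length_def by blast
qed

lemma word_length_le: "set ws \<subseteq> letters S \<Longrightarrow> word_length G S (word_prod ws) \<le> length ws"
  unfolding word_length_def by (rule Least_le) blast

lemma finite_word_ball:
  assumes "finite S" "S \<subseteq> carrier G"
  shows "finite {h \<in> generate G S. word_length G S h \<le> n}"
proof (rule finite_subset)
  show "{h \<in> generate G S. word_length G S h \<le> n}
      \<subseteq> word_prod ` {ws. set ws \<subseteq> letters S \<and> length ws \<le> n}"
  proof
    fix h assume "h \<in> {h \<in> generate G S. word_length G S h \<le> n}"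
    then show "h \<in> word_prod ` {ws. set ws \<subseteq> letters S \<and> length ws \<le> n}"
      using word_length_witness[OF assms(2), of h] by (smt (verit) image_eqI mem_Collect_eq)
  qed
  show "finite (word_prod ` {ws. set ws \<subseteq> letters S \<and> length ws \<le> n})"
    using assms(1) by (intro finite_imageI finite_lists_length_le) auto
qed

text \<open>The chain runs through \<open>g\<close> times the prefixes of the word. Each step is a
  translate of the step from \<open>x\<close> to \<open>\<phi> w x\<close> for a letter
  \<open>w\<close>, and an inverse letter displaces \<open>x\<close> as far as the letter.\<close>

lemma word_chain:
  assumes "subgroup H G" "S \<subseteq> H" "\<And>s. s \<in> S \<Longrightarrow> dist x (\<phi> s x) \<le> L"
    and "set ws \<subseteq> letters S" "g \<in> H"
  shows "joined_by_chain ((\<lambda>h. \<phi> h x) ` H) L (length ws) (\<phi> g x) (\<phi> (g \<otimes> word_prod ws) x)"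
  using assms(4,5)
proof (induction ws arbitrary: g)
  case Nil
  then show ?case
    using subgroup.mem_carrier[OF assms(1)]
    unfolding joined_by_chain_def by (intro exI[of _ "\<lambda>_. \<phi> g x"]) auto
next
  case (Cons w ws)
  have H: "H \<subseteq> carrier G" using assms(1) subgroup.subset by blast
  have letters: "letters S \<subseteq> H"
    using assms(1,2) by (auto intro: subgroup.m_inv_closed)
  moreover have "w \<in> letters S" "set ws \<subseteq> letters S" using Cons.prems(1) by simp_all
  ultimately have w: "w \<in> H" "set ws \<subseteq> H" by blast+
  have gw: "g \<otimes> w \<in> H" using assms(1) Cons.prems(2) w(1) by (rule subgroup.m_closed)
  have "dist x (\<phi> w x) \<le> L"
    using Cons.prems(1) assms(2,3) H dist_inv by auto
  then have "dist (\<phi> g x) (\<phi> (g \<otimes> w) x) \<le> L"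
    using Cons.prems(2) w H act_mult dist_act by (metis subsetD)
  moreover have "g \<otimes> w \<otimes> word_prod ws = g \<otimes> word_prod (w # ws)"
    using Cons.prems(2) w H word_prod_closed[of ws] by (auto intro!: m_assoc)
  ultimately show ?case
    using joined_by_chain_Suc[OF _ _ Cons.IH[of "g \<otimes> w"]] Cons.prems gw by auto
qed

lemma generators_displacement_bound:
  assumes "finite S"
  obtains L where "0 \<le> L" "\<And>s. s \<in> S \<Longrightarrow> dist x (\<phi> s x) \<le> L"
proof -
  have "bdd_above ((\<lambda>s. dist x (\<phi> s x)) ` S)" using assms by simp
  then obtain L where "\<And>s. s \<in> S \<Longrightarrow> dist x (\<phi> s x) \<le> L"
    unfolding bdd_above_def by auto
  then have "\<And>s. s \<in> S \<Longrightarrow> dist x (\<phi> s x) \<le> max 0 L" by force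
  then show thesis using that[of "max 0 L"] by simp
qed

section \<open>Quasi-isometric embeddings and quasiconvex orbits\<close>

text \<open>The lower quasi-isometry inequality solved for the word length; moving to an arbitrary
  base point \<open>x\<close> only enlarges the additive constant.\<close>

lemma qi_embedded_word_bound:
  assumes "qi_embedded G \<phi> H"
  obtains S K C where "finite S" "S \<subseteq> carrier G" "generate G S = H" "0 \<le> (K::real)"
    "\<And>g h. g \<in> H \<Longrightarrow> h \<in> H
      \<Longrightarrow> real (word_length G S (inv g \<otimes> h)) \<le> K * dist (\<phi> g x) (\<phi> h x) + C"
proof -
  obtain S y where S: "finite S" "S \<subseteq> carrier G" "generate G S = H"
    and qi: "quasi_isometric_embedding H (word_dist G S) (\<lambda>h. \<phi> h y)"
    using assms unfolding qi_embedded_def finite_generating_set_def by blast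
  obtain K C where K: "1 \<le> K"
    "\<And>g h. g \<in> H \<Longrightarrow> h \<in> H \<Longrightarrow> word_dist G S g h / K - C \<le> dist (\<phi> g y) (\<phi> h y)"
    using qi unfolding quasi_isometric_embedding_def by blast
  have H: "H \<subseteq> carrier G" using S generate_incl by blast
  have "real (word_length G S (inv g \<otimes> h)) \<le> K * dist (\<phi> g x) (\<phi> h x) + K * (2 * dist y x + C)"
    if "g \<in> H" "h \<in> H" for g h
  proof -
    have "word_dist G S g h / K \<le> dist (\<phi> g x) (\<phi> h x) + (2 * dist y x + C)"
      using K(2)[OF that] dist_change_base[of g h y x] subsetD[OF H that(1)] subsetD[OF H that(2)]
      by linarith
    then show ?thesis
      using K(1) by (simp add: word_dist_def divide_le_eq algebra_simps)
  qed
  moreover have "0 \<le> K" using K(1) by simp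
  ultimately show thesis using that[OF S] by blast
qed

text \<open>Bounded displacement bounds the word length, and word balls are finite.\<close>

lemma qi_embedded_finite_ball:
  assumes "qi_embedded G \<phi> H" "subgroup H G"
  shows "finite {h \<in> H. dist x (\<phi> h x) \<le> r}"
proof -
  obtain S K C where S: "finite S" "S \<subseteq> carrier G" "generate G S = H" "0 \<le> K"
    "\<And>g h. g \<in> H \<Longrightarrow> h \<in> H
      \<Longrightarrow> real (word_length G S (inv g \<otimes> h)) \<le> K * dist (\<phi> g x) (\<phi> h x) + C"
    using qi_embedded_word_bound[OF assms(1), of x] by metis
  have "word_length G S h \<le> nat \<lceil>K * r + C\<rceil>" if "h \<in> H" "dist x (\<phi> h x) \<le> r" for h
  proof -
    have "real (word_length G S h) \<le> K * dist x (\<phi> h x) + C"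
      using S(5)[of \<one> h] that(1) assms(2) subgroup.one_closed subgroup.mem_carrier
      by (fastforce simp: act_one)
    also have "\<dots> \<le> K * r + C" using that(2) S(4) by (simp add: mult_left_mono)
    finally show ?thesis by linarith
  qed
  then have "{h \<in> H. dist x (\<phi> h x) \<le> r} \<subseteq> {h \<in> generate G S. word_length G S h \<le> nat \<lceil>K * r + C\<rceil>}"
    using S(3) by blast
  then show ?thesis by (rule finite_subset) (rule finite_word_ball[OF S(1,2)])
qed

text \<open>A shortest word for \<open>inv g \<otimes> h\<close> traces a chain in the orbit whose
  number of steps is linear in the distance.\<close>

lemma qi_embedded_quasiconvex:
  assumes "hyperbolic_space TYPE('x)" "qi_embedded G \<phi> H" "subgroup H G"
  shows "\<exists>D\<ge>0. quasiconvex_with D ((\<lambda>h. \<phi> h x) ` H)"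
proof -
  obtain S K C where S: "finite S" "S \<subseteq> carrier G" "generate G S = H" "0 \<le> K"
    "\<And>g h. g \<in> H \<Longrightarrow> h \<in> H
      \<Longrightarrow> real (word_length G S (inv g \<otimes> h)) \<le> K * dist (\<phi> g x) (\<phi> h x) + C"
    using qi_embedded_word_bound[OF assms(2), of x] by metis
  obtain L where L: "0 \<le> L" "\<And>s. s \<in> S \<Longrightarrow> dist x (\<phi> s x) \<le> L"
    using generators_displacement_bound[OF S(1), of x] by metis
  have "\<exists>n. real n \<le> K * dist u v + C \<and> joined_by_chain ((\<lambda>h. \<phi> h x) ` H) L n u v"
    if uv: "u \<in> (\<lambda>h. \<phi> h x) ` H" "v \<in> (\<lambda>h. \<phi> h x) ` H" for u v
  proof -
    obtain g h where gh: "g \<in> H" "u = \<phi> g x" "h \<in> H" "v = \<phi> h x" using uv by blast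
    have c: "g \<in> carrier G" "h \<in> carrier G"
      using gh subgroup.mem_carrier[OF assms(3)] by auto
    have mem: "inv g \<otimes> h \<in> generate G S"
      using gh assms(3) S(3) by (simp add: subgroup.m_closed subgroup.m_inv_closed)
    obtain ws where ws: "length ws = word_length G S (inv g \<otimes> h)" "set ws \<subseteq> letters S"
      "word_prod ws = inv g \<otimes> h"
      using word_length_witness[OF S(2) mem] by blast
    have "g \<otimes> word_prod ws = h" using c ws(3) by (simp add: m_assoc[symmetric])
    moreover have "S \<subseteq> H" using S(3) generate.incl by fastforce
    ultimately have "joined_by_chain ((\<lambda>h. \<phi> h x) ` H) L (length ws) u v"
      using word_chain[OF assms(3) _ L(2) ws(2) gh(1)] gh by auto
    then show ?thesis using S(5)[OF gh(1,3)] ws(1) gh by auto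
  qed
  then show ?thesis
    using quasiconvex_if_joined_by_linear_chains[OF assms(1) _ S(4) L(1)] by blast
qed

text \<open>Sample a geodesic from \<open>x\<close> to \<open>\<phi> h x\<close> at unit intervals
  and replace each sample by an orbit point within \<open>D\<close>. The quotients of consecutive
  group elements lie in the finite set \<open>T\<close> and multiply to \<open>h\<close>.\<close>

lemma quasiconvex_imp_qi_embedded:
  assumes "geodesic_space TYPE('x)" "subgroup H G"
    and fin: "\<And>r. finite {h \<in> H. dist x (\<phi> h x) \<le> r}"
    and D: "0 \<le> D" "quasiconvex_with D ((\<lambda>h. \<phi> h x) ` H)"
  shows "qi_embedded G \<phi> H"
proof -
  define T where "T = {h \<in> H. dist x (\<phi> h x) \<le> 2 * D + 1}"
  have H: "H \<subseteq> carrier G" using assms(2) subgroup.subset by blast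
  have T: "finite T" "T \<subseteq> H" using fin by (auto simp: T_def)
  have word: "\<exists>ws. set ws \<subseteq> T \<and> word_prod ws = h \<and> real (length ws) \<le> dist x (\<phi> h x) + 1"
    if h: "h \<in> H" for h
  proof -
    define l where "l = dist x (\<phi> h x)"
    obtain \<gamma> where \<gamma>: "\<gamma> 0 = x" "\<gamma> l = \<phi> h x"
      "geodesic_segment x (\<phi> h x) (\<gamma> ` {0..l})"
      "\<And>s t. s \<in> {0..l} \<Longrightarrow> t \<in> {0..l} \<Longrightarrow> dist (\<gamma> s) (\<gamma> t) = \<bar>s - t\<bar>"
      using assms(1) unfolding geodesic_space_def geodesic_segment_def l_def by metis
    define n where "n = nat \<lceil>l\<rceil>"
    have l: "0 \<le> l" "l \<le> real n" "real n \<le> l + 1" by (auto simp: n_def l_def)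
    \<comment> \<open>Sample number \<open>n\<close> may overshoot \<open>l\<close>; clamping puts
      it at the end point.\<close>
    define \<tau> where "\<tau> i = min (real i) l" for i
    have one: "\<one> \<in> H" using assms(2) by (rule subgroup.one_closed)
    have orb: "x \<in> (\<lambda>h. \<phi> h x) ` H" using one act_one[of x] by (metis imageI)
    \<comment> \<open>The end samples are prescribed exactly. For \<open>n = 0\<close> both would
      claim index \<open>0\<close>, although \<open>h\<close> need not be
      \<open>\<one>\<close>.\<close>
    have "\<exists>c\<in>H. dist (\<phi> c x) (\<gamma> (\<tau> i)) \<le> D \<and> (i = 0 \<longrightarrow> c = \<one>) \<and> (i = n \<longrightarrow> c = h)"
      if "0 < n" for i
    proof -
      consider "i = 0" | "i = n" "i \<noteq> 0" | "i \<noteq> 0" "i \<noteq> n" by blast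
      then show ?thesis
      proof cases
        case 1
        then show ?thesis using \<open>0 < n\<close> one D(1) \<gamma>(1) l(1) by (auto simp: act_one \<tau>_def)
      next
        case 2
        then show ?thesis using h D(1) \<gamma>(2) l(2) by (auto simp: \<tau>_def min_def)
      next
        case 3
        have "\<gamma> (\<tau> i) \<in> \<gamma> ` {0..l}" using l(1) by (simp add: \<tau>_def)
        then obtain q where "q \<in> (\<lambda>h. \<phi> h x) ` H" "dist (\<gamma> (\<tau> i)) q \<le> D"
          using D(2) \<gamma>(3) orb h unfolding quasiconvex_with_def by blast
        then show ?thesis using 3 by (auto simp: dist_commute)
      qed
    qed
    then obtain c where c: "\<And>i. 0 < n \<Longrightarrow> c i \<in> H"
      "\<And>i. 0 < n \<Longrightarrow> dist (\<phi> (c i) x) (\<gamma> (\<tau> i)) \<le> D" "0 < n \<Longrightarrow> c 0 = \<one>" "0 < n \<Longrightarrow> c n = h"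
      by metis
    show ?thesis
    proof (cases "n = 0")
      \<comment> \<open>Here \<open>h\<close> fixes \<open>x\<close> but may differ from
        \<open>\<one>\<close>; it is its own one-letter word, which the \<open>+ 1\<close> in the
        length bound permits.\<close>
      case True
      then have "dist x (\<phi> h x) = 0" using l by (simp add: l_def)
      then have "h \<in> T" using h D(1) by (simp add: T_def)
      then show ?thesis using H h by (intro exI[of _ "[h]"]) auto
    next
      case False
      then have "0 < n" by simp
      have step: "inv (c i) \<otimes> c (Suc i) \<in> T" for i
      proof -
        have "dist (\<gamma> (\<tau> i)) (\<gamma> (\<tau> (Suc i))) \<le> 1"
          using \<gamma>(4)[of "\<tau> i" "\<tau> (Suc i)"] l(1) by (auto simp: \<tau>_def min_def)
        then have "dist (\<phi> (c i) x) (\<phi> (c (Suc i)) x) \<le> 2 * D + 1"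
          using c(2)[OF \<open>0 < n\<close>, of i] c(2)[OF \<open>0 < n\<close>, of "Suc i"]
            dist_triangle[of "\<phi> (c i) x" "\<phi> (c (Suc i)) x" "\<gamma> (\<tau> i)"]
            dist_triangle[of "\<gamma> (\<tau> i)" "\<phi> (c (Suc i)) x" "\<gamma> (\<tau> (Suc i))"]
          by (simp add: dist_commute)
        then show ?thesis
          using c(1)[OF \<open>0 < n\<close>] H assms(2) dist_orbit
          by (auto simp: T_def subgroup.m_closed subgroup.m_inv_closed subset_iff)
      qed
      \<comment> \<open>The last \<open>j\<close> quotients telescope; for \<open>j = n\<close> the
        product is \<open>h\<close>, as \<open>c 0 = \<one>\<close>.\<close>
      have "\<exists>ws. set ws \<subseteq> T \<and> word_prod ws = inv (c (n - j)) \<otimes> h \<and> length ws = j" if "j \<le> n" for j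
        using that
      proof (induction j)
        case 0
        then show ?case using c(4) \<open>0 < n\<close> h H by (auto intro!: l_inv[symmetric])
      next
        case (Suc j)
        then obtain ws where ws: "set ws \<subseteq> T" "word_prod ws = inv (c (n - j)) \<otimes> h" "length ws = j"
          by auto
        let ?i = "n - Suc j"
        have i: "Suc ?i = n - j" using Suc.prems by simp
        have car: "c k \<in> carrier G" for k using c(1)[OF \<open>0 < n\<close>] H by blast
        have "c (n - j) \<otimes> (inv (c (n - j)) \<otimes> h) = h"
          using car subsetD[OF H h] by (simp flip: m_assoc)
        then have "word_prod ((inv (c ?i) \<otimes> c (Suc ?i)) # ws) = inv (c ?i) \<otimes> h"
          using car subsetD[OF H h] by (simp add: ws(2) i m_assoc)
        then show ?case
          using ws step[of ?i] by (intro exI[of _ "(inv (c ?i) \<otimes> c (Suc ?i)) # ws"]) auto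
      qed
      from this[of n] have "\<exists>ws. set ws \<subseteq> T \<and> word_prod ws = h \<and> length ws = n"
        using c(3) \<open>0 < n\<close> subsetD[OF H h] by simp
      then show ?thesis using l(3) by (auto simp: l_def)
    qed
  qed
  have "generate G T = H"
  proof
    show "generate G T \<subseteq> H" using generate_subgroup_incl[OF T(2) assms(2)] .
    have "word_prod ws \<in> generate G T" if "set ws \<subseteq> T" for ws
      using that by (induction ws) (auto intro: generate.intros)
    then show "H \<subseteq> generate G T" using word by blast
  qed
  \<comment> \<open>Each letter displaces \<open>x\<close> by at most \<open>2 * D + 1\<close>; the
    additive \<open>1\<close> comes from rounding up the length of the geodesic.\<close>
  moreover have "word_dist G T g h / (2 * D + 1) - 1 \<le> dist (\<phi> g x) (\<phi> h x)
      \<and> dist (\<phi> g x) (\<phi> h x) \<le> (2 * D + 1) * word_dist G T g h + 1"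
    if gh: "g \<in> H" "h \<in> H" for g h
  proof -
    let ?k = "inv g \<otimes> h"
    have k: "?k \<in> H" using gh assms(2) by (simp add: subgroup.m_closed subgroup.m_inv_closed)
    have dk: "dist x (\<phi> ?k x) = dist (\<phi> g x) (\<phi> h x)" using dist_orbit gh H by blast
    obtain ws where "set ws \<subseteq> T" "word_prod ws = ?k" "real (length ws) \<le> dist x (\<phi> ?k x) + 1"
      using word[OF k] by blast
    then have upper: "word_dist G T g h \<le> dist x (\<phi> ?k x) + 1"
      using word_length_le[of ws T] by (force simp: word_dist_def)
    have "word_dist G T g h / (2 * D + 1) \<le> word_dist G T g h"
      using D(1) by (simp add: word_dist_def divide_le_eq algebra_simps)
    moreover obtain vs where vs: "length vs = word_length G T ?k" "set vs \<subseteq> letters T"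
      "word_prod vs = ?k"
      using word_length_witness[OF order_trans[OF T(2) H]] k \<open>generate G T = H\<close> by metis
    have "joined_by_chain ((\<lambda>h. \<phi> h x) ` H) (2 * D + 1) (length vs) (\<phi> \<one> x)
        (\<phi> (\<one> \<otimes> word_prod vs) x)"
      using word_chain[OF assms(2) T(2) _ vs(2) subgroup.one_closed[OF assms(2)]]
      by (simp add: T_def)
    then have "dist x (\<phi> ?k x) \<le> word_dist G T g h * (2 * D + 1)"
      using joined_by_chain_dist_le vs k H by (fastforce simp: act_one word_dist_def subset_iff)
    ultimately show ?thesis using upper dk by (simp add: mult.commute)
  qed
  ultimately show ?thesis
    unfolding qi_embedded_def finite_generating_set_def quasi_isometric_embedding_def
    using T H D(1) by (intro exI[of _ T] exI[of _ x] conjI exI[of _ "2 * D + 1"] exI[of _ "1::real"]) auto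
qed

section \<open>Quasiconvexity of the intersection\<close>

text \<open>For two elements \<open>g\<close> and \<open>g0\<close> of the set,
  \<open>g \<otimes> inv g0\<close> moves \<open>y\<close> and \<open>z\<close> by at most
  \<open>2 * \<epsilon>\<close>. The set is therefore covered by a right translate of the finite
  one.\<close>

lemma finite_double_coarse_stabiliser:
  assumes fin: "finite {g \<in> carrier G. dist (\<phi> g y) y \<le> 2 * \<epsilon> \<and> dist (\<phi> g z) z \<le> 2 * \<epsilon>}"
  shows "finite {g \<in> carrier G. dist (\<phi> g x) y \<le> \<epsilon> \<and> dist (\<phi> g w) z \<le> \<epsilon>}" (is "finite ?F")
proof (cases "?F = {}")
  case False
  then obtain g0 where g0: "g0 \<in> carrier G" "dist (\<phi> g0 x) y \<le> \<epsilon>" "dist (\<phi> g0 w) z \<le> \<epsilon>"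
    by blast
  have move: "dist (\<phi> (g \<otimes> inv g0) q) q \<le> 2 * \<epsilon>"
    if "g \<in> carrier G" "dist (\<phi> g p) q \<le> \<epsilon>" "dist (\<phi> g0 p) q \<le> \<epsilon>" for g p q
  proof -
    have "\<phi> (g \<otimes> inv g0) (\<phi> g0 p) = \<phi> g p"
      using that(1) g0(1) by (simp flip: act_mult add: m_assoc)
    then have "dist (\<phi> (g \<otimes> inv g0) q) (\<phi> g p) = dist q (\<phi> g0 p)"
      using dist_act[of "g \<otimes> inv g0" q "\<phi> g0 p"] that(1) g0(1) by simp
    then show ?thesis
      using that dist_triangle[of "\<phi> (g \<otimes> inv g0) q" q "\<phi> g p"] by (simp add: dist_commute)
  qed
  have "?F \<subseteq> (\<lambda>k. k \<otimes> g0) ` {g \<in> carrier G. dist (\<phi> g y) y \<le> 2 * \<epsilon> \<and> dist (\<phi> g z) z \<le> 2 * \<epsilon>}"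
  proof
    fix g assume g: "g \<in> ?F"
    then have "g \<otimes> inv g0 \<in> {g \<in> carrier G. dist (\<phi> g y) y \<le> 2 * \<epsilon> \<and> dist (\<phi> g z) z \<le> 2 * \<epsilon>}"
      using move g0 by auto
    moreover have "g = g \<otimes> inv g0 \<otimes> g0" using g g0(1) by (simp add: m_assoc)
    ultimately show "g \<in> (\<lambda>k. k \<otimes> g0) ` {g \<in> carrier G. dist (\<phi> g y) y \<le> 2 * \<epsilon> \<and> dist (\<phi> g z) z \<le> 2 * \<epsilon>}"
      by blast
  qed
  then show ?thesis using fin finite_surj by blast
qed (metis finite.emptyI)

text \<open>For \<open>a x\<close> and \<open>b x\<close> close to a point \<open>p\<close> of the geodesic and \<open>a' x\<close>, \<open>b' x\<close> close to a point
  at a fixed distance from \<open>p\<close>, the element \<open>a\<inverse> b\<close> moves \<open>x\<close> and \<open>b\<inverse> b' x\<close> close to \<open>x\<close> and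
  \<open>a\<inverse> a' x\<close>, and there are finitely many possibilities for \<open>a\<inverse> a'\<close> and \<open>b\<inverse> b'\<close>.\<close>

lemma quasiconvex_Int:
  assumes sub: "subgroup A G" "subgroup B G"
    and finA: "\<And>r. finite {h \<in> A. dist x (\<phi> h x) \<le> r}"
    and finB: "\<And>r. finite {h \<in> B. dist x (\<phi> h x) \<le> r}"
    and qcA: "0 \<le> D" "quasiconvex_with D ((\<lambda>h. \<phi> h x) ` A)"
    and qcB: "quasiconvex_with D ((\<lambda>h. \<phi> h x) ` B)"
    and acyl: "acylindrical_along_set G \<phi> ((\<lambda>h. \<phi> h x) ` A)"
  shows "\<exists>D'\<ge>0. quasiconvex_with D' ((\<lambda>h. \<phi> h x) ` (A \<inter> B))"
proof -
  have AB: "A \<subseteq> carrier G" "B \<subseteq> carrier G" using sub subgroup.subset by blast+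
  \<comment> \<open>Orbit points near a common geodesic point are within \<open>2 * D\<close> of
    each other, and \<open>finite_double_coarse_stabiliser\<close> doubles this tolerance.\<close>
  have "0 \<le> 2 * (2 * D)" using qcA(1) by simp
  from acyl[unfolded acylindrical_along_set_def, rule_format, OF this] obtain R where R: "0 < R"
    "\<And>y z. y \<in> (\<lambda>h. \<phi> h x) ` A \<Longrightarrow> z \<in> (\<lambda>h. \<phi> h x) ` A \<Longrightarrow> R \<le> dist y z \<Longrightarrow>
      finite {g \<in> carrier G. dist (\<phi> g y) y \<le> 2 * (2 * D) \<and> dist (\<phi> g z) z \<le> 2 * (2 * D)}"
    by blast
  \<comment> \<open>Points within \<open>D\<close> of two geodesic points at distance
    \<open>r\<close> are at least \<open>R\<close> apart, as acylindricity requires.\<close>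
  define r where "r = R + 2 * D"
  have r: "0 \<le> r" using R(1) qcA(1) by (simp add: r_def)
  \<comment> \<open>\<open>U\<close>, \<open>V\<close> and \<open>F\<close> hold the possible values
    of \<open>inv a \<otimes> a'\<close>, \<open>inv b \<otimes> b'\<close> and
    \<open>inv a \<otimes> b\<close>.\<close>
  define U where "U = {u \<in> A. R \<le> dist x (\<phi> u x) \<and> dist x (\<phi> u x) \<le> r + 2 * D}"
  define V where "V = {v \<in> B. dist x (\<phi> v x) \<le> r + 2 * D}"
  define F where "F = (\<Union>u\<in>U. \<Union>v\<in>V.
    {g \<in> carrier G. dist (\<phi> g x) x \<le> 2 * D \<and> dist (\<phi> g (\<phi> v x)) (\<phi> u x) \<le> 2 * D})"
  have "finite U" by (rule finite_subset[OF _ finA[of "r + 2 * D"]]) (auto simp: U_def)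
  moreover have "finite V" using finB by (simp add: V_def)
  \<comment> \<open>Acylindricity is applied at the targets \<open>x\<close> and
    \<open>\<phi> u x\<close>, both in the orbit of \<open>A\<close>; the source
    \<open>\<phi> v x\<close> may lie off it.\<close>
  moreover have "finite {g \<in> carrier G. dist (\<phi> g x) x \<le> 2 * D \<and> dist (\<phi> g (\<phi> v x)) (\<phi> u x) \<le> 2 * D}"
    if "u \<in> U" for u v
  proof (rule finite_double_coarse_stabiliser[OF R(2)])
    show "x \<in> (\<lambda>h. \<phi> h x) ` A"
      using subgroup.one_closed[OF sub(1)] act_one[of x] by (metis imageI)
  qed (use that in \<open>auto simp: U_def\<close>)
  ultimately have "finite F" unfolding F_def by blast
  \<comment> \<open>The choice depends on \<open>g\<close> alone, so over the finite set
    \<open>F\<close> its displacement is bounded.\<close>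
  define c where "c g = (SOME a. a \<in> A \<and> a \<otimes> g \<in> B)" for g
  have c: "c g \<in> A \<and> c g \<otimes> g \<in> B" if "a \<in> A" "a \<otimes> g \<in> B" for a g
    unfolding c_def by (rule someI[of _ a]) (use that in blast)
  obtain L where L: "\<And>s. s \<in> c ` F \<Longrightarrow> dist x (\<phi> s x) \<le> L"
    using generators_displacement_bound[of "c ` F" x] \<open>finite F\<close> by blast
  \<comment> \<open>\<open>r\<close> serves points with less than \<open>r\<close> of the geodesic
    ahead of them, which are near its end point; \<open>D + L\<close> serves the others.\<close>
  define D' where "D' = max r (D + L)"
  have "\<exists>q\<in>(\<lambda>h. \<phi> h x) ` (A \<inter> B). dist p q \<le> D'"
    if h: "h1 \<in> A \<inter> B" "h2 \<in> A \<inter> B" and S: "geodesic_segment (\<phi> h1 x) (\<phi> h2 x) S" "p \<in> S"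
    for h1 h2 S p
  proof -
    define l where "l = dist (\<phi> h1 x) (\<phi> h2 x)"
    obtain \<gamma> where \<gamma>: "\<gamma> l = \<phi> h2 x" "S = \<gamma> ` {0..l}"
      "\<And>s t. s \<in> {0..l} \<Longrightarrow> t \<in> {0..l} \<Longrightarrow> dist (\<gamma> s) (\<gamma> t) = \<bar>s - t\<bar>"
      using S(1) unfolding geodesic_segment_def l_def by blast
    obtain t where t: "t \<in> {0..l}" "p = \<gamma> t" using S(2) \<gamma>(2) by blast
    show ?thesis
    proof (cases "t + r \<le> l")
      case False
      have "dist p (\<phi> h2 x) = l - t" using \<gamma>(1) \<gamma>(3)[of t l] t by auto
      then have "dist p (\<phi> h2 x) \<le> D'" using False by (simp add: D'_def)
      then show ?thesis using h(2) by blast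
    next
      case True
      define p' where "p' = \<gamma> (t + r)"
      have pp': "p' \<in> S" "dist p p' = r"
        using \<gamma>(2) \<gamma>(3)[of t "t + r"] t True r by (auto simp: p'_def)
      have nearA: "\<exists>a\<in>A. dist q (\<phi> a x) \<le> D" if "q \<in> S" for q
        using qcA(2) S(1) h that unfolding quasiconvex_with_def by blast
      have nearB: "\<exists>b\<in>B. dist q (\<phi> b x) \<le> D" if "q \<in> S" for q
        using qcB S(1) h that unfolding quasiconvex_with_def by blast
      obtain a a' b b' where
        a: "a \<in> A" "dist p (\<phi> a x) \<le> D" "a' \<in> A" "dist p' (\<phi> a' x) \<le> D" and
        b: "b \<in> B" "dist p (\<phi> b x) \<le> D" "b' \<in> B" "dist p' (\<phi> b' x) \<le> D"
        using nearA[OF S(2)] nearB[OF S(2)] nearA[OF pp'(1)] nearB[OF pp'(1)] by blast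
      have car: "a \<in> carrier G" "a' \<in> carrier G" "b \<in> carrier G" "b' \<in> carrier G"
        using a b AB by auto
      define g where "g = inv a \<otimes> b"
      have g: "g \<in> carrier G" "a \<otimes> g = b" using car by (auto simp: g_def m_assoc[symmetric])
      have "inv a \<otimes> a' \<in> U"
      proof -
        have "dist (\<phi> a x) (\<phi> a' x) \<le> r + 2 * D" "R \<le> dist (\<phi> a x) (\<phi> a' x)"
          using a(2,4) pp'(2) dist_triangle[of "\<phi> a x" "\<phi> a' x" p] dist_triangle[of p "\<phi> a' x" p']
            dist_triangle[of p p' "\<phi> a x"] dist_triangle[of "\<phi> a x" p' "\<phi> a' x"]
          by (auto simp: dist_commute r_def)
        then show ?thesis
          using a(1,3) sub(1) car dist_orbit
          by (auto simp: U_def subgroup.m_closed subgroup.m_inv_closed)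
      qed
      moreover have "inv b \<otimes> b' \<in> V"
      proof -
        have "dist (\<phi> b x) (\<phi> b' x) \<le> r + 2 * D"
          using b(2,4) pp'(2) dist_triangle[of "\<phi> b x" "\<phi> b' x" p] dist_triangle[of p "\<phi> b' x" p']
          by (auto simp: dist_commute)
        then show ?thesis
          using b(1,3) sub(2) car dist_orbit
          by (auto simp: V_def subgroup.m_closed subgroup.m_inv_closed)
      qed
      moreover have "dist (\<phi> g x) x \<le> 2 * D"
        using a(2) b(2) dist_triangle[of "\<phi> a x" "\<phi> b x" p] dist_orbit[of a b x] car
        by (simp add: g_def dist_commute)
      moreover have "dist (\<phi> g (\<phi> (inv b \<otimes> b') x)) (\<phi> (inv a \<otimes> a') x) \<le> 2 * D"
      proof -
        have "b \<otimes> (inv b \<otimes> b') = b'" using car by (simp flip: m_assoc)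
        then have "g \<otimes> (inv b \<otimes> b') = inv a \<otimes> b'"
          using car by (simp add: g_def m_assoc)
        then have "\<phi> g (\<phi> (inv b \<otimes> b') x) = \<phi> (inv a) (\<phi> b' x)"
          using car g(1) by (simp flip: act_mult)
        then have "dist (\<phi> g (\<phi> (inv b \<otimes> b') x)) (\<phi> (inv a \<otimes> a') x) = dist (\<phi> b' x) (\<phi> a' x)"
          using car by (simp add: act_mult dist_act)
        then show ?thesis
          using a(4) b(4) dist_triangle[of "\<phi> b' x" "\<phi> a' x" p'] by (simp add: dist_commute)
      qed
      ultimately have "g \<in> F" unfolding F_def using g(1) by blast
      have cg: "c g \<in> A" "c g \<otimes> g \<in> B" using c[of a g] a(1) b(1) g(2) by auto
      then have cc: "c g \<in> carrier G" using AB by blast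
      \<comment> \<open>Since \<open>a \<otimes> g = b\<close>, this is also
        \<open>b \<otimes> inv (c g \<otimes> g)\<close>, hence in \<open>A\<close> and in
        \<open>B\<close>; its orbit point is within \<open>L\<close> of
        \<open>\<phi> a x\<close>.\<close>
      define k where "k = a \<otimes> inv (c g)"
      have "k \<in> A"
        using a(1) cg(1) sub(1) by (simp add: k_def subgroup.m_closed subgroup.m_inv_closed)
      moreover have "g \<otimes> (inv g \<otimes> inv (c g)) = inv (c g)"
        using g(1) cc by (simp flip: m_assoc)
      then have "k = b \<otimes> inv (c g \<otimes> g)"
        unfolding k_def g(2)[symmetric] using car(1) cc g(1) by (simp add: inv_mult_group m_assoc)
      then have "k \<in> B"
        using b(1) cg(2) sub(2) by (simp add: subgroup.m_closed subgroup.m_inv_closed)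
      moreover have "dist p (\<phi> k x) \<le> D'"
      proof -
        have "dist (\<phi> a x) (\<phi> k x) = dist x (\<phi> (c g) x)"
          using car cc by (simp add: k_def act_mult dist_act dist_inv)
        also have "\<dots> \<le> L" using L \<open>g \<in> F\<close> by blast
        finally show ?thesis
          using a(2) dist_triangle[of p "\<phi> k x" "\<phi> a x"] by (simp add: D'_def)
      qed
      ultimately show ?thesis by blast
    qed
  qed
  then show ?thesis
    using r unfolding quasiconvex_with_def by (intro exI[of _ D']) (auto simp: D'_def)
qed

end

lemma quasiconvex_with_mono: "\<lbrakk>quasiconvex_with D Y; D \<le> E\<rbrakk> \<Longrightarrow> quasiconvex_with E Y"
  unfolding quasiconvex_with_def by (meson order_trans)

lemma acylindrical_along_set_subset:
  "\<lbrakk>acylindrical_along_set G \<phi> Y; Z \<subseteq> Y\<rbrakk> \<Longrightarrow> acylindrical_along_set G \<phi> Z"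
  unfolding acylindrical_along_set_def by (meson subsetD)

text \<open>\<open>A \<inter> B\<close> may be finite while a triple demands an infinite subgroup,
  so only the triple itself is conditional on infinity.\<close>

theorem proposition4p1:
  fixes G :: "('g, 'm) monoid_scheme"
    and \<phi> :: "'g \<Rightarrow> 'x::metric_space \<Rightarrow> 'x"
    and A B :: "'g set"
  assumes "AQI_triple G \<phi> A"
    and "subgroup B G"
    and "infinite B"
    and "qi_embedded G \<phi> B"
  shows "(infinite (A \<inter> B) \<longrightarrow> AQI_triple G \<phi> (A \<inter> B)) \<and>
         subgroup (A \<inter> B) G \<and> finitely_generated G (A \<inter> B) \<and>
         acylindrical_along_subgroup G \<phi> (A \<inter> B) \<and> qi_embedded G \<phi> (A \<inter> B)"
proof -
  have hyp: "hyperbolic_space TYPE('x)" and G: "group G" "isometric_action G \<phi>"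
    and A: "subgroup A G" "acylindrical_along_subgroup G \<phi> A" "qi_embedded G \<phi> A"
    using assms(1) unfolding AQI_triple_def by auto
  interpret isometric_group_action G \<phi>
    by (intro isometric_group_action.intro isometric_group_action_axioms.intro G)
  obtain x where x: "acylindrical_along_set G \<phi> ((\<lambda>h. \<phi> h x) ` A)"
    using A(2) unfolding acylindrical_along_subgroup_def by blast
  obtain D1 D2 where D: "0 \<le> D1" "quasiconvex_with D1 ((\<lambda>h. \<phi> h x) ` A)"
    "quasiconvex_with D2 ((\<lambda>h. \<phi> h x) ` B)"
    using qi_embedded_quasiconvex[OF hyp A(3,1)] qi_embedded_quasiconvex[OF hyp assms(4,2)] by blast
  note finA = qi_embedded_finite_ball[OF A(3,1)] and finB = qi_embedded_finite_ball[OF assms(4,2)]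
  have max: "0 \<le> max D1 D2" "quasiconvex_with (max D1 D2) ((\<lambda>h. \<phi> h x) ` A)"
    "quasiconvex_with (max D1 D2) ((\<lambda>h. \<phi> h x) ` B)"
    using D by (auto elim: quasiconvex_with_mono)
  obtain D' where D': "0 \<le> D'" "quasiconvex_with D' ((\<lambda>h. \<phi> h x) ` (A \<inter> B))"
    using quasiconvex_Int[OF A(1) assms(2) finA finB max x] by blast
  have sub: "subgroup (A \<inter> B) G" using A(1) assms(2) by (rule subgroups_Inter_pair)
  have "finite {h \<in> A \<inter> B. dist x (\<phi> h x) \<le> r}" for r
    by (rule finite_subset[OF _ finA[of x r]]) blast
  then have qi: "qi_embedded G \<phi> (A \<inter> B)"
    using quasiconvex_imp_qi_embedded[OF _ sub _ D'] hyp unfolding hyperbolic_space_def by blast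
  have fg: "finitely_generated G (A \<inter> B)"
    using qi unfolding qi_embedded_def finitely_generated_def by blast
  have "acylindrical_along_subgroup G \<phi> (A \<inter> B)"
    unfolding acylindrical_along_subgroup_def
    using acylindrical_along_set_subset[OF x] by (meson Int_lower1 image_mono)
  then show ?thesis
    using hyp G sub fg qi unfolding AQI_triple_def by blast
qed

end
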